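(* The strict competitive ratio of the algorithm Random is at least $1/n^{O(n)}$ in the adversarial arrival model. That is, there is an absolute constant $C>0$ such that for every number of agents $n\ge 1$ and every input sequence $\sigma$, $$\mathbb{E}[\mathrm{Random}(\sigma)]\ \ge\ \frac{1}{n^{Cn}}\,\mathrm{OPT}(\sigma).$$
   Context: Setting (online max-min fair allocation, adversarial arrival). There are agents $N=\{1,\dots,n\}$; a finite sequence $\sigma$ of items, fixed in advance by an oblivious adversary, arrives one by one, and each item must be irrevocably given to one agent on arrival. Agent $i$ values item $e$ at $v_i(e)\in[0,1]$, and $v_i(X)=\sum_{e\in X}v_i(e)$. $\mathrm{OPT}(\sigma)$ is the maximum over all allocations (partitions $(A_1,\dots,A_n)$ of the items) of $\min_{i\in N}v_i(A_i)$. Random gives each arriving item to an agent chosen uniformly at random from $N$, independently across items, and $\mathrm{Random}(\sigma)=\min_{i\in N}v_i(A_i)$ for the resulting allocation. The strict competitive ratio of an online algorithm $\mathrm{ALG}$ is $\inf_\sigma \mathbb{E}[\mathrm{ALG}(\sigma)]/\mathrm{OPT}(\sigma)$ (over $\sigma$ with $\mathrm{OPT}(\sigma)>0$). *)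

theory Defs
  imports "HOL-Probability.Probability" "HOL-Probability.Product_PMF"
begin

text \<open>
  The agents are \<open>{1..n}\<close>. An item is identified with its vector of values, so \<open>e i\<close> is
  the value of item \<open>e\<close> for agent \<open>i\<close>. The items of an input sequence are addressed by
  their positions, so that equal entries of the list are still different items.
\<close>

type_synonym item = "nat \<Rightarrow> real"

definition agents :: "nat \<Rightarrow> nat set" where
  "agents n = {1..n}"

definition input_sequence :: "nat \<Rightarrow> item list \<Rightarrow> bool" where
  "input_sequence n \<sigma> \<longleftrightarrow> (\<forall>e\<in>set \<sigma>. \<forall>i\<in>agents n. 0 \<le> e i \<and> e i \<le> 1)"

definition bundle_value :: "item list \<Rightarrow> nat \<Rightarrow> nat set \<Rightarrow> real" where
  "bundle_value \<sigma> i X = (\<Sum>j\<in>X. (\<sigma> ! j) i)"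

definition allocation :: "nat \<Rightarrow> item list \<Rightarrow> (nat \<Rightarrow> nat set) \<Rightarrow> bool" where
  "allocation n \<sigma> A \<longleftrightarrow>
     disjoint_family_on A (agents n) \<and> (\<Union>i\<in>agents n. A i) = {..<length \<sigma>}"

definition min_value :: "nat \<Rightarrow> item list \<Rightarrow> (nat \<Rightarrow> nat set) \<Rightarrow> real" where
  "min_value n \<sigma> A = Min ((\<lambda>i. bundle_value \<sigma> i (A i)) ` agents n)"

definition OPT :: "nat \<Rightarrow> item list \<Rightarrow> real" where
  "OPT n \<sigma> = Max (min_value n \<sigma> ` {A. allocation n \<sigma> A})"

text \<open>
  \<open>allocation\<close> does not constrain \<open>A\<close> outside \<open>agents n\<close>, so there are infinitely many such
  \<open>A\<close>, but \<open>min_value\<close> takes only finitely many values on them, and the maximum is attained.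
\<close>

lemma finite_allocation_values: "finite (min_value n \<sigma> ` {A. allocation n \<sigma> A})"
proof (rule finite_subset)
  show "min_value n \<sigma> ` {A. allocation n \<sigma> A}
          \<subseteq> min_value n \<sigma> ` (agents n \<rightarrow>\<^sub>E Pow {..<length \<sigma>})"
  proof
    fix x assume "x \<in> min_value n \<sigma> ` {A. allocation n \<sigma> A}"
    then obtain A where A: "allocation n \<sigma> A" "x = min_value n \<sigma> A" by blast
    have "restrict A (agents n) \<in> agents n \<rightarrow>\<^sub>E Pow {..<length \<sigma>}"
      using A(1) unfolding allocation_def restrict_PiE_iff by blast
    moreover have "x = min_value n \<sigma> (restrict A (agents n))"
      using A(2) by (simp add: min_value_def cong: image_cong)
    ultimately show "x \<in> min_value n \<sigma> ` (agents n \<rightarrow>\<^sub>E Pow {..<length \<sigma>})" by blast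
  qed
  show "finite (min_value n \<sigma> ` (agents n \<rightarrow>\<^sub>E Pow {..<length \<sigma>}))"
    by (intro finite_imageI finite_PiE) (auto simp: agents_def)
qed

lemma allocation_exists:
  assumes "n \<ge> 1"
  shows "allocation n \<sigma> (\<lambda>i. if i = 1 then {..<length \<sigma>} else {})"
  using assms by (auto simp: allocation_def agents_def disjoint_family_on_def)

text \<open>
  A randomized algorithm is given by the distribution of the allocation it produces on each
  input sequence.
\<close>

type_synonym algorithm = "item list \<Rightarrow> (nat \<Rightarrow> nat set) pmf"

definition expected_value :: "nat \<Rightarrow> algorithm \<Rightarrow> item list \<Rightarrow> real" where
  "expected_value n ALG \<sigma> = measure_pmf.expectation (ALG \<sigma>) (min_value n \<sigma>)"

definition strict_competitive_ratio :: "nat \<Rightarrow> algorithm \<Rightarrow> real" where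
  "strict_competitive_ratio n ALG =
     (INF \<sigma>\<in>{\<sigma>. input_sequence n \<sigma> \<and> OPT n \<sigma> > 0}. expected_value n ALG \<sigma> / OPT n \<sigma>)"

text \<open>
  \<open>f j\<close> is the agent who receives the item in position \<open>j\<close>; the \<open>f j\<close> are independent and
  uniform on the agents. The value \<open>0\<close> of \<open>f\<close> outside the positions of \<open>\<sigma>\<close> is never used.
\<close>

definition Random :: "nat \<Rightarrow> algorithm" where
  "Random n \<sigma> =
     map_pmf (\<lambda>f i. {j. j < length \<sigma> \<and> f j = i})
       (Pi_pmf {..<length \<sigma>} 0 (\<lambda>_. pmf_of_set (agents n)))"

end

theory Submission imports Defs begin

text \<open>
  Fix an optimal allocation \<open>A\<close> with minimum \<open>V\<close>, and colour the items uniformly at random with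
  the agents. By pigeonhole every agent \<open>i\<close> has a colour \<open>c i\<close> whose part of \<open>A i\<close> has value at
  least \<open>V / n\<close> for \<open>i\<close>. There are \<open>n ^ n\<close> vectors \<open>c\<close> of such colours. Since the sets \<open>A i\<close> are
  disjoint, the colours can be permuted separately on each of them, so all vectors are equally
  likely to work. Hence \<open>c i = i\<close> works with probability at least \<open>1 / n ^ n\<close>, in which case Random
  has value at least \<open>V / n\<close>, and \<open>n + 1 \<le> 2 n\<close>.
\<close>

text \<open>If every colour class fell short of the average \<open>V / card I\<close>, summing over
  the colours would give less than \<open>V\<close>.\<close>

lemma pigeonhole_colour:
  fixes w :: "'b \<Rightarrow> real"
  assumes "finite I" "I \<noteq> {}" "finite B" "f ` B \<subseteq> I" "V \<le> sum w B"
  shows "\<exists>c\<in>I. V / real (card I) \<le> sum w {j \<in> B. f j = c}"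
proof (rule ccontr)
  assume "\<not> ?thesis"
  then have "sum w {j \<in> B. f j = c} < V / real (card I)" if "c \<in> I" for c
    using that by auto
  then have "(\<Sum>c\<in>I. sum w {j \<in> B. f j = c}) < (\<Sum>c\<in>I. V / real (card I))"
    using assms(1,2) by (intro sum_strict_mono) auto
  moreover have "(\<Sum>c\<in>I. sum w {j \<in> B. f j = c}) = sum w B"
    using assms(1,3,4) by (intro sum.group)
  moreover have "(\<Sum>c\<in>I. V / real (card I)) = V"
    using assms(1,2) by simp
  ultimately show False using assms(5) by simp
qed

text \<open>A union bound over the colour vectors, combined with an injection of each event into the
  one for the identity vector. Working with cardinalities suffices because the colouring drawn by
  Random is uniform on a set of the form \<open>S\<close>, with \<open>d\<close> as the dummy value
  outside \<open>J\<close>.\<close>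

lemma card_colourings_le:
  fixes w :: "'a \<Rightarrow> 'b \<Rightarrow> real" and d :: 'a
  assumes fin: "finite I" "finite J" and ne: "I \<noteq> {}"
    and disj: "disjoint_family_on A I" and cover: "(\<Union>i\<in>I. A i) = J"
    and V: "\<And>i. i \<in> I \<Longrightarrow> V \<le> sum (w i) (A i)"
  defines "S \<equiv> PiE_dflt J d (\<lambda>_. I)"
  shows "card S \<le> card I ^ card I *
    card {f \<in> S. \<forall>i\<in>I. V / real (card I) \<le> sum (w i) {j \<in> A i. f j = i}}"
proof -
  \<comment> \<open>\<open>E c\<close> is the event that the colour vector \<open>c\<close> works;
    the event of interest is \<open>E (\<lambda>i. i)\<close>.\<close>
  define E where "E c = {f \<in> S. \<forall>i\<in>I. V / real (card I) \<le> sum (w i) {j \<in> A i. f j = c i}}" for c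
  have finS: "finite S" unfolding S_def using fin by (intro finite_PiE_dflt) auto
  then have finE: "finite (E c)" for c unfolding E_def by simp
  have "\<forall>j\<in>J. \<exists>i. i \<in> I \<and> j \<in> A i" using cover by blast
  \<comment> \<open>\<open>own j\<close> is the agent whose bundle contains \<open>j\<close>, unique
    by disjointness.\<close>
  then obtain own where own: "\<And>j. j \<in> J \<Longrightarrow> own j \<in> I \<and> j \<in> A (own j)"
    by metis
  have own_eq: "own j = i" if "i \<in> I" "j \<in> A i" for i j
    using own[of j] that disj cover unfolding disjoint_family_on_def by blast
  have card_E: "card (E c) \<le> card (E (\<lambda>i. i))" if c: "c \<in> I \<rightarrow>\<^sub>E I" for c
  proof (rule card_inj_on_le)
    \<comment> \<open>On the bundle of each agent \<open>i\<close>, exchange the colours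
      \<open>i\<close> and \<open>c i\<close>. The exchange is chosen per bundle, so
      \<open>c\<close> need not be injective. Keeping \<open>d\<close> outside \<open>J\<close>
      makes \<open>swap\<close> an involution on \<open>S\<close>, hence injective there.\<close>
    define swap where
      "swap f j = (if j \<in> J then Transposition.transpose (own j) (c (own j)) (f j) else d)" for f j
    have swap_swap: "swap (swap f) = f" if "f \<in> S" for f
      using that by (auto simp: swap_def S_def PiE_dflt_def fun_eq_iff)
    show "inj_on swap (E c)"
      by (rule inj_on_inverseI[where g = swap]) (auto simp: E_def swap_swap)
    show "swap ` E c \<subseteq> E (\<lambda>i. i)"
    proof
      fix g assume "g \<in> swap ` E c"
      then obtain f where f: "f \<in> E c" "g = swap f" by blast
      have "g j \<in> I" if "j \<in> J" for j
      proof -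
        have "f j \<in> I" using f(1) that by (simp add: E_def S_def PiE_dflt_def)
        moreover have "own j \<in> I" "c (own j) \<in> I" using own[OF that] c by auto
        ultimately show ?thesis using that by (simp add: f(2) swap_def Transposition.transpose_def)
      qed
      then have "g \<in> S" by (simp add: S_def PiE_dflt_def f(2) swap_def)
      moreover have "{j \<in> A i. g j = i} = {j \<in> A i. f j = c i}" if i: "i \<in> I" for i
      proof -
        have "g j = Transposition.transpose i (c i) (f j)" if "j \<in> A i" for j
        proof -
          have "j \<in> J" using cover i that by blast
          then show ?thesis by (simp add: f(2) swap_def own_eq[OF i that])
        qed
        \<comment> \<open>Only the colour \<open>c i\<close> is sent to \<open>i\<close>, so inside
          \<open>A i\<close> the class of colour \<open>i\<close> under \<open>g\<close> is exactly
          the class of colour \<open>c i\<close> under \<open>f\<close>.\<close>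
        moreover have "Transposition.transpose i (c i) x = i \<longleftrightarrow> x = c i" for x
          by (auto simp: transpose_eq_iff)
        ultimately show ?thesis by (intro Collect_cong conj_cong refl) simp
      qed
      ultimately show "g \<in> E (\<lambda>i. i)" using f(1) by (simp add: E_def)
    qed
  qed (rule finE)
  have "S \<subseteq> (\<Union>c\<in>I \<rightarrow>\<^sub>E I. E c)"
  proof
    fix f assume f: "f \<in> S"
    have "\<forall>i\<in>I. \<exists>c\<in>I. V / real (card I) \<le> sum (w i) {j \<in> A i. f j = c}"
    proof
      fix i assume i: "i \<in> I"
      with cover have "A i \<subseteq> J" by blast
      with f i show "\<exists>c\<in>I. V / real (card I) \<le> sum (w i) {j \<in> A i. f j = c}"
        by (intro pigeonhole_colour fin ne V)
          (auto simp: S_def PiE_dflt_def intro: finite_subset[OF _ fin(2)])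
    qed
    then obtain c where "\<forall>i\<in>I. c i \<in> I \<and> V / real (card I) \<le> sum (w i) {j \<in> A i. f j = c i}"
      by metis
    \<comment> \<open>\<open>E c\<close> depends only on the values of \<open>c\<close> on
      \<open>I\<close>; restricting puts \<open>c\<close> into a finite index set with
      \<open>card I ^ card I\<close> elements.\<close>
    then have "restrict c I \<in> I \<rightarrow>\<^sub>E I" "f \<in> E (restrict c I)"
      using f by (auto simp: E_def)
    then show "f \<in> (\<Union>c\<in>I \<rightarrow>\<^sub>E I. E c)" by blast
  qed
  then have "card S \<le> card (\<Union>c\<in>I \<rightarrow>\<^sub>E I. E c)"
    by (intro card_mono) (auto intro!: finite_PiE fin finE)
  also have "\<dots> \<le> (\<Sum>c\<in>I \<rightarrow>\<^sub>E I. card (E c))"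
    by (intro card_UN_le finite_PiE fin)
  also have "\<dots> \<le> (\<Sum>c\<in>I \<rightarrow>\<^sub>E I. card (E (\<lambda>i. i)))"
    by (intro sum_mono card_E)
  also have "\<dots> = card I ^ card I * card (E (\<lambda>i. i))"
    by (simp add: card_PiE fin)
  finally show ?thesis by (simp add: E_def)
qed

lemma min_value_ge_iff:
  assumes "n \<ge> 1"
  shows "x \<le> min_value n \<sigma> A \<longleftrightarrow> (\<forall>i\<in>agents n. x \<le> bundle_value \<sigma> i (A i))"
  using assms unfolding min_value_def by (subst Min_ge_iff) (auto simp: agents_def)

lemma bundle_value_mono:
  assumes "input_sequence n \<sigma>" "i \<in> agents n" "X \<subseteq> Y" "Y \<subseteq> {..<length \<sigma>}"
  shows "bundle_value \<sigma> i X \<le> bundle_value \<sigma> i Y"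
  unfolding bundle_value_def
proof (rule sum_mono2)
  show "finite Y" using assms(4) finite_subset by blast
  show "0 \<le> (\<sigma> ! j) i" if "j \<in> Y - X" for j
  proof -
    have "\<sigma> ! j \<in> set \<sigma>" using that assms(4) by auto
    then show ?thesis using assms(1,2) by (auto simp: input_sequence_def)
  qed
qed (fact assms(3))

lemma OPT_ge:
  assumes "allocation n \<sigma> A"
  shows "min_value n \<sigma> A \<le> OPT n \<sigma>"
  unfolding OPT_def using assms by (intro Max_ge finite_allocation_values) auto

lemma OPT_attained:
  assumes "n \<ge> 1"
  obtains A where "allocation n \<sigma> A" "OPT n \<sigma> = min_value n \<sigma> A"
proof -
  have "OPT n \<sigma> \<in> min_value n \<sigma> ` {A. allocation n \<sigma> A}"
    unfolding OPT_def using allocation_exists[OF assms]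
    by (intro Max_in finite_allocation_values) auto
  then show thesis using that by blast
qed

lemma min_value_nonneg:
  assumes "n \<ge> 1" "input_sequence n \<sigma>" "\<And>i. i \<in> agents n \<Longrightarrow> A i \<subseteq> {..<length \<sigma>}"
  shows "0 \<le> min_value n \<sigma> A"
  using bundle_value_mono[OF assms(2) _ empty_subsetI assms(3)]
  by (subst min_value_ge_iff[OF assms(1)]) (auto simp: bundle_value_def)

lemma OPT_nonneg:
  assumes "n \<ge> 1" "input_sequence n \<sigma>"
  shows "0 \<le> OPT n \<sigma>"
proof -
  have "0 \<le> min_value n \<sigma> (\<lambda>i. if i = 1 then {..<length \<sigma>} else {})"
    by (rule min_value_nonneg[OF assms]) simp
  with OPT_ge[OF allocation_exists[OF assms(1)]] show ?thesis by (rule order_trans[rotated])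
qed

text \<open>Supplies an input with positive optimum, so that the infimum defining the competitive
  ratio ranges over a nonempty set.\<close>

lemma OPT_replicate_one_pos:
  assumes "n \<ge> 1"
  shows "0 < OPT n (replicate n (\<lambda>_. 1))"
proof -
  \<comment> \<open>Agents are numbered from 1 and positions from 0, so agent \<open>i\<close> gets
    the item in position \<open>i - 1\<close>.\<close>
  let ?A = "\<lambda>i::nat. {i - 1}"
  have "(\<Union>i\<in>agents n. ?A i) = {..<n}"
  proof
    show "{..<n} \<subseteq> (\<Union>i\<in>agents n. ?A i)"
    proof
      fix j assume "j \<in> {..<n}"
      then have "Suc j \<in> agents n" "j \<in> ?A (Suc j)" by (auto simp: agents_def)
      then show "j \<in> (\<Union>i\<in>agents n. ?A i)" by blast
    qed
  qed (auto simp: agents_def)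
  then have "allocation n (replicate n (\<lambda>_. 1)) ?A"
    by (auto simp: allocation_def disjoint_family_on_def agents_def)
  moreover have "1 \<le> min_value n (replicate n (\<lambda>_. 1)) ?A"
    unfolding min_value_ge_iff[OF assms] by (auto simp: bundle_value_def agents_def)
  ultimately show ?thesis using OPT_ge by fastforce
qed

text \<open>Independent uniform colours form a uniform colouring, so the expectation is a plain
  average and bounding it reduces to counting.\<close>

lemma expected_value_Random_eq:
  assumes "n \<ge> 1"
  defines "S \<equiv> \<lambda>\<sigma>. PiE_dflt {..<length \<sigma>} 0 (\<lambda>_. agents n)"
  shows "expected_value n (Random n) \<sigma> =
    (\<Sum>f\<in>S \<sigma>. min_value n \<sigma> (\<lambda>i. {j. j < length \<sigma> \<and> f j = i})) / card (S \<sigma>)"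
    and "finite (S \<sigma>)" and "S \<sigma> \<noteq> {}"
proof -
  have ag: "finite (agents n)" "agents n \<noteq> {}" using assms(1) by (auto simp: agents_def)
  show fin: "finite (S \<sigma>)" unfolding S_def using ag by (intro finite_PiE_dflt) auto
  show ne: "S \<sigma> \<noteq> {}" unfolding S_def using ag by simp
  have "Pi_pmf {..<length \<sigma>} 0 (\<lambda>_. pmf_of_set (agents n)) = pmf_of_set (S \<sigma>)"
    unfolding S_def using ag by (intro Pi_pmf_of_set) auto
  then show "expected_value n (Random n) \<sigma> =
    (\<Sum>f\<in>S \<sigma>. min_value n \<sigma> (\<lambda>i. {j. j < length \<sigma> \<and> f j = i})) / card (S \<sigma>)"
    using fin ne by (simp add: expected_value_def Random_def integral_pmf_of_set)
qed

lemma expected_value_Random_ge: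
  assumes n: "n \<ge> 1" and \<sigma>: "input_sequence n \<sigma>"
  shows "expected_value n (Random n) \<sigma> \<ge> OPT n \<sigma> / real n ^ (n + 1)"
proof -
  obtain A where A: "allocation n \<sigma> A" "OPT n \<sigma> = min_value n \<sigma> A"
    using OPT_attained[OF n] .
  define S where "S = PiE_dflt {..<length \<sigma>} (0::nat) (\<lambda>_. agents n)"
  define E where "E = {f \<in> S. \<forall>i\<in>agents n.
    OPT n \<sigma> / real n \<le> bundle_value \<sigma> i {j \<in> A i. f j = i}}"
  let ?val = "\<lambda>f. min_value n \<sigma> (\<lambda>i. {j. j < length \<sigma> \<and> f j = i})"
  have S: "finite S" "S \<noteq> {}" "expected_value n (Random n) \<sigma> = (\<Sum>f\<in>S. ?val f) / card S"
    unfolding S_def using expected_value_Random_eq[OF n] by blast+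
  have card_agents: "card (agents n) = n" "finite (agents n)" "agents n \<noteq> {}"
    using n by (auto simp: agents_def)
  have cover: "A i \<subseteq> {..<length \<sigma>}" if "i \<in> agents n" for i
    using A(1) that by (auto simp: allocation_def)
  have "card S \<le> n ^ n * card E"
    using card_colourings_le[of "agents n" "{..<length \<sigma>}" A "OPT n \<sigma>" "\<lambda>i j. (\<sigma> ! j) i" 0]
      A card_agents min_value_ge_iff[OF n, of "OPT n \<sigma>" \<sigma> A]
    by (simp add: allocation_def S_def E_def bundle_value_def)
  then have card_le: "real (card S) \<le> real n ^ n * real (card E)"
    by (metis of_nat_le_iff of_nat_mult of_nat_power)
  have "OPT n \<sigma> / real n \<le> ?val f" if "f \<in> E" for f
    unfolding min_value_ge_iff[OF n]
  proof
    fix i assume i: "i \<in> agents n"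
    with that have "OPT n \<sigma> / real n \<le> bundle_value \<sigma> i {j \<in> A i. f j = i}"
      by (simp add: E_def)
    \<comment> \<open>Items of colour \<open>i\<close> outside \<open>A i\<close> also go to agent
      \<open>i\<close>, and they can only add value.\<close>
    also have "\<dots> \<le> bundle_value \<sigma> i {j. j < length \<sigma> \<and> f j = i}"
      using cover[OF i] by (intro bundle_value_mono[OF \<sigma> i]) auto
    finally show "OPT n \<sigma> / real n \<le> bundle_value \<sigma> i {j. j < length \<sigma> \<and> f j = i}" .
  qed
  then have "card E * (OPT n \<sigma> / real n) \<le> (\<Sum>f\<in>E. ?val f)"
    by (rule sum_bounded_below)
  \<comment> \<open>Colourings outside \<open>E\<close> contribute nonnegative values.\<close>
  also have "\<dots> \<le> (\<Sum>f\<in>S. ?val f)"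
    by (intro sum_mono2 S min_value_nonneg[OF n \<sigma>]) (auto simp: E_def)
  finally have sum_ge: "card E * (OPT n \<sigma> / real n) \<le> (\<Sum>f\<in>S. ?val f)" .
  \<comment> \<open>In the exponent \<open>n + 1\<close>, the power \<open>n ^ n\<close> pays for
    the count of colour vectors and the remaining factor \<open>n\<close> for the pigeonhole
    loss.\<close>
  have "OPT n \<sigma> / real n ^ (n + 1) * card S
      \<le> OPT n \<sigma> / real n ^ (n + 1) * (real n ^ n * real (card E))"
    using OPT_nonneg[OF n \<sigma>] by (intro mult_left_mono card_le) auto
  also have "\<dots> = card E * (OPT n \<sigma> / real n)"
    using n by simp
  also note sum_ge
  finally show ?thesis
    using S by (simp add: pos_le_divide_eq card_gt_0_iff)
qed

theorem theorem2:
  "\<exists>C::real. C > 0 \<and>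
     (\<forall>n::nat. n \<ge> 1 \<longrightarrow>
        strict_competitive_ratio n (Random n) \<ge> 1 / real n powr (C * real n) \<and>
        (\<forall>\<sigma>. input_sequence n \<sigma> \<longrightarrow>
           expected_value n (Random n) \<sigma> \<ge> 1 / real n powr (C * real n) * OPT n \<sigma>))"
proof (intro exI[of _ "2::real"] conjI allI impI)
  fix n :: nat assume n: "n \<ge> 1"
  have bound: "expected_value n (Random n) \<sigma> \<ge> 1 / real n powr (2 * real n) * OPT n \<sigma>"
    if \<sigma>: "input_sequence n \<sigma>" for \<sigma>
  proof -
    have "real n ^ (n + 1) \<le> real n ^ (2 * n)"
      using n by (intro power_increasing) auto
    also have "\<dots> = real n powr (2 * real n)"
      using n powr_realpow[of "real n" "2 * n"] by simp
    finally have "OPT n \<sigma> / real n powr (2 * real n) \<le> OPT n \<sigma> / real n ^ (n + 1)"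
      using n OPT_nonneg[OF n \<sigma>] by (intro divide_left_mono) auto
    with expected_value_Random_ge[OF n \<sigma>] show ?thesis by simp
  qed
  then show "expected_value n (Random n) \<sigma> \<ge> 1 / real n powr (2 * real n) * OPT n \<sigma>"
    if "input_sequence n \<sigma>" for \<sigma> using that .
  show "strict_competitive_ratio n (Random n) \<ge> 1 / real n powr (2 * real n)"
    unfolding strict_competitive_ratio_def
  proof (rule cINF_greatest)
    have "input_sequence n (replicate n (\<lambda>_. 1))" by (simp add: input_sequence_def)
    with OPT_replicate_one_pos[OF n]
    show "{\<sigma>. input_sequence n \<sigma> \<and> OPT n \<sigma> > 0} \<noteq> {}" by blast
  next
    fix \<sigma> assume "\<sigma> \<in> {\<sigma>. input_sequence n \<sigma> \<and> OPT n \<sigma> > 0}"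
    with bound[of \<sigma>] show "1 / real n powr (2 * real n) \<le> expected_value n (Random n) \<sigma> / OPT n \<sigma>"
      by (simp add: pos_le_divide_eq)
  qed
qed simp

end
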